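(* Suppose that the reference wave satisfies $E_{\mathrm{r}}(t)=0$ for all $t$. Let $\theta_{\mathrm{c}}\in\mathbb{R}$ be given, and let $\theta_{\mathrm{in}}^{+},\theta_{\mathrm{in}}^{-}\in\mathbb{R}$. If the conditions $$f_{\mathrm{c}}(t) = \sqrt{2}\,\sin(2\omega_{\mathrm{in}} t+\theta_{\mathrm{c}})\quad\text{for all } t,\qquad \theta_{\mathrm{in}}^{+} = -\theta_{\mathrm{in}}^{-},$$ hold, then the steady-state performance index is given by $$J_{\mathrm{ss}}(E_{\mathrm{r}}, f_{\mathrm{c}}, \theta_{\mathrm{in}}^{+}, \theta_{\mathrm{in}}^{-}) = \frac{\bigl| I_{1}\,\tilde{A}^{2}\,\sin(2\theta_{\mathrm{in}}^{-})\,\cos(\theta_{\mathrm{c}}-2\theta_{\mathrm{ss}})\bigr|}{\sqrt{2}},$$ where $$\theta_{\mathrm{ss}} := -\arctan\frac{\gamma\,\omega_{\mathrm{in}}}{k-m\,\omega_{\mathrm{in}}^{2}}.$$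
   Context: Constants: $m>0$ (effective mass), $\gamma>0$ (viscosity), $k>0$ (elasticity), $\omega_{\mathrm{in}}>0$ (frequency), and real constants $q$ (charge), $A_{\mathrm{in}}$ (amplitude), $I_1$ (current coefficient). Incoming waves: for phases $\theta_{\mathrm{in}}^{+},\theta_{\mathrm{in}}^{-}\in\mathbb{R}$, put $E_{\mathrm{in}}^{\pm}(t) := A_{\mathrm{in}}\cos(\omega_{\mathrm{in}} t+\theta_{\mathrm{in}}^{\pm})$. The reference wave $E_{\mathrm{r}}$ and the carrier signal $f_{\mathrm{c}}$ are real-valued functions of time $t$. Put $T_1 := 2\pi/\omega_{\mathrm{in}}$. Steady state: for a continuous $T_1$-periodic wave $E(t)$, $x_E(t)$ denotes the steady state solution, i.e. the (unique) $T_1$-periodic solution $\tilde{x}$ of $m\,\tilde{x}''(t)+\gamma\,\tilde{x}'(t)+k\,\tilde{x}(t) = q\,E(t)$. The steady state displacements corresponding to the two phases are $x_{\mathrm{ss}}^{\pm}(t) := x_{E}(t)$ with $E=E_{\mathrm{in}}^{\pm}-E_{\mathrm{r}}$, i.e. the steady state solutions of $m x''+\gamma x'+k x = q\,(E_{\mathrm{in}}^{\pm}-E_{\mathrm{r}})$. Steady-state performance index: $$J_{\mathrm{ss}}(E_{\mathrm{r}}, f_{\mathrm{c}}, \theta_{\mathrm{in}}^{+}, \theta_{\mathrm{in}}^{-}) := \left|\frac{I_1}{T_1}\int_0^{T_1}\bigl(x_{\mathrm{ss}}^{+}(t)+x_{\mathrm{ss}}^{-}(t)\bigr)\bigl(x_{\mathrm{ss}}^{+}(t)-x_{\mathrm{ss}}^{-}(t)\bigr)f_{\mathrm{c}}(t)\,dt\right|.$$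 Coefficient: $$\tilde{A} := \frac{q\,A_{\mathrm{in}}}{\sqrt{(k-m\omega_{\mathrm{in}}^2)^2+(\gamma\omega_{\mathrm{in}})^2}}.$$ Here $\arctan$ takes values in $(-\pi/2,\pi/2)$; in the resonant case $k=m\omega_{\mathrm{in}}^2$ the expression defining $\theta_{\mathrm{ss}}$ is read as $-\pi/2$. *)

theory Defs
  imports "HOL-Analysis.Analysis"
begin

definition is_periodic_solution ::
  "real \<Rightarrow> real \<Rightarrow> real \<Rightarrow> real \<Rightarrow> real \<Rightarrow> (real \<Rightarrow> real) \<Rightarrow> (real \<Rightarrow> real) \<Rightarrow> bool" where
  "is_periodic_solution m \<gamma> k q T E x \<longleftrightarrow>
     (\<forall>t. x (t + T) = x t) \<and>
     (\<exists>x' x''. \<forall>t. (x has_real_derivative x' t) (at t) \<and>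
                (x' has_real_derivative x'' t) (at t) \<and>
                m * x'' t + \<gamma> * x' t + k * x t = q * E t)"

text \<open>
  The definite description is meaningful only where the \<open>T\<close>-periodic solution is unique,
  which is the case for \<open>m, \<gamma>, k, T > 0\<close> and continuous \<open>T\<close>-periodic \<open>E\<close>.
\<close>
definition steady_state ::
  "real \<Rightarrow> real \<Rightarrow> real \<Rightarrow> real \<Rightarrow> real \<Rightarrow> (real \<Rightarrow> real) \<Rightarrow> real \<Rightarrow> real" where
  "steady_state m \<gamma> k q T E = (THE x. is_periodic_solution m \<gamma> k q T E x)"

definition period :: "real \<Rightarrow> real" where
  "period \<omega> = 2 * pi / \<omega>"

definition E_in :: "real \<Rightarrow> real \<Rightarrow> real \<Rightarrow> real \<Rightarrow> real" where
  "E_in A \<omega> \<theta> t = A * cos (\<omega> * t + \<theta>)"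

definition x_ss ::
  "real \<Rightarrow> real \<Rightarrow> real \<Rightarrow> real \<Rightarrow> real \<Rightarrow> real \<Rightarrow> (real \<Rightarrow> real) \<Rightarrow> real \<Rightarrow> real \<Rightarrow> real" where
  "x_ss m \<gamma> k q \<omega> A E\<^sub>r \<theta> =
     steady_state m \<gamma> k q (period \<omega>) (\<lambda>t. E_in A \<omega> \<theta> t - E\<^sub>r t)"

definition J_ss ::
  "real \<Rightarrow> real \<Rightarrow> real \<Rightarrow> real \<Rightarrow> real \<Rightarrow> real \<Rightarrow> real \<Rightarrow>
   (real \<Rightarrow> real) \<Rightarrow> (real \<Rightarrow> real) \<Rightarrow> real \<Rightarrow> real \<Rightarrow> real" where
  "J_ss m \<gamma> k q \<omega> A I\<^sub>1 E\<^sub>r f\<^sub>c \<theta>p \<theta>m =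
     \<bar>I\<^sub>1 / period \<omega> *
       integral {0..period \<omega>}
         (\<lambda>t. (x_ss m \<gamma> k q \<omega> A E\<^sub>r \<theta>p t + x_ss m \<gamma> k q \<omega> A E\<^sub>r \<theta>m t) *
              (x_ss m \<gamma> k q \<omega> A E\<^sub>r \<theta>p t - x_ss m \<gamma> k q \<omega> A E\<^sub>r \<theta>m t) * f\<^sub>c t)\<bar>"

definition A_tilde :: "real \<Rightarrow> real \<Rightarrow> real \<Rightarrow> real \<Rightarrow> real \<Rightarrow> real \<Rightarrow> real" where
  "A_tilde m \<gamma> k q \<omega> A = q * A / sqrt ((k - m * \<omega>\<^sup>2)\<^sup>2 + (\<gamma> * \<omega>)\<^sup>2)"

text \<open>
  At resonance the value is \<open>- pi / 2\<close>; the explicit case distinction is needed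
  because division by zero would yield \<open>- arctan 0 = 0\<close>.
\<close>
definition theta_ss :: "real \<Rightarrow> real \<Rightarrow> real \<Rightarrow> real \<Rightarrow> real" where
  "theta_ss m \<gamma> k \<omega> =
     (if k = m * \<omega>\<^sup>2 then - pi / 2 else - arctan (\<gamma> * \<omega> / (k - m * \<omega>\<^sup>2)))"

end

theory Submission
  imports Defs
begin

text \<open>
  The energy \<open>m x'\<^sup>2 + k x\<^sup>2\<close> of a solution of the homogeneous equation has derivative
  \<open>- 2 \<gamma> x'\<^sup>2\<close>; being both decreasing and periodic it is constant, which forces \<open>x' = 0\<close>
  and hence \<open>x = 0\<close>. So periodic solutions are unique, and the steady state is the sinusoid
  with amplitude \<open>\<plusminus> A_tilde\<close> and phase shift \<open>theta_ss\<close>. The sign, which is negative above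
  resonance because of the branch of the arctangent, disappears in the quadratic performance
  index, leaving the mean of a product of two sines of frequency \<open>2 \<omega>\<close>.
\<close>

text \<open>For \<open>a \<le> b \<le> a + T\<close> monotonicity gives
  \<open>e a \<ge> e b \<ge> e (a + T) = e a\<close>. Agreement within distance \<open>T\<close> of
  each point is all that is needed to conclude that a derivative of \<open>e\<close> vanishes
  there.\<close>

lemma periodic_antimono_imp_const:
  fixes e :: "real \<Rightarrow> real"
  assumes "antimono e" and "\<And>t. e (t + T) = e t" and "\<bar>x - y\<bar> < T"
  shows "e x = e y"
proof -
  have "e b = e a" if "a \<le> b" "b \<le> a + T" for a b
    using antimonoD[OF assms(1) that(1)] antimonoD[OF assms(1) that(2)] assms(2)[of a] by simp
  from this[of x y] this[of y x] show ?thesis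
    using assms(3) by linarith
qed

lemma is_periodic_solution_diff:
  assumes "is_periodic_solution m \<gamma> k q T E x" and "is_periodic_solution m \<gamma> k q T E y"
  shows "is_periodic_solution m \<gamma> k q T (\<lambda>_. 0) (\<lambda>t. x t - y t)"
proof -
  obtain x' x'' where x: "\<And>t. (x has_real_derivative x' t) (at t)"
      "\<And>t. (x' has_real_derivative x'' t) (at t)"
      "\<And>t. m * x'' t + \<gamma> * x' t + k * x t = q * E t"
    using assms(1) unfolding is_periodic_solution_def by blast
  obtain y' y'' where y: "\<And>t. (y has_real_derivative y' t) (at t)"
      "\<And>t. (y' has_real_derivative y'' t) (at t)"
      "\<And>t. m * y'' t + \<gamma> * y' t + k * y t = q * E t"
    using assms(2) unfolding is_periodic_solution_def by blast
  have "m * (x'' t - y'' t) + \<gamma> * (x' t - y' t) + k * (x t - y t) = 0" for t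
    using x(3)[of t] y(3)[of t] by (simp add: algebra_simps)
  moreover have "((\<lambda>t. x t - y t) has_real_derivative x' t - y' t) (at t)"
    "((\<lambda>t. x' t - y' t) has_real_derivative x'' t - y'' t) (at t)" for t
    using x y by (auto intro: DERIV_diff)
  ultimately show ?thesis
    using assms unfolding is_periodic_solution_def
    by (intro conjI exI[of _ "\<lambda>t. x' t - y' t"] exI[of _ "\<lambda>t. x'' t - y'' t"]) auto
qed

lemma homogeneous_periodic_solution_eq_0:
  assumes "m > 0" "\<gamma> > 0" "k > 0" "T > 0"
    and "is_periodic_solution m \<gamma> k q T (\<lambda>_. 0) z"
  shows "z t = 0"
proof -
  have per: "z (t + T) = z t" for t
    using assms(5) by (simp add: is_periodic_solution_def)
  obtain z' z'' where z: "\<And>t. (z has_real_derivative z' t) (at t)"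
      "\<And>t. (z' has_real_derivative z'' t) (at t)"
      "\<And>t. m * z'' t + \<gamma> * z' t + k * z t = 0"
    using assms(5) unfolding is_periodic_solution_def by auto
  have per': "z' (t + T) = z' t" for t
  proof -
    \<comment> \<open>Shifting the argument turns the derivative at \<open>t + T\<close> into one at
      \<open>t\<close>, so uniqueness of derivatives passes the period on to \<open>z'\<close> and
      thus to the energy.\<close>
    have "(z has_real_derivative z' (t + T)) (at t)"
      using z(1)[of "t + T"] per by (simp add: DERIV_shift)
    then show ?thesis using z(1) DERIV_unique by blast
  qed
  define e where "e = (\<lambda>t. m * (z' t)\<^sup>2 + k * (z t)\<^sup>2)"
  have de: "(e has_real_derivative - 2 * \<gamma> * (z' t)\<^sup>2) (at t)" for t
  proof -
    have "(e has_real_derivative 2 * z' t * (m * z'' t + k * z t)) (at t)"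
      unfolding e_def
      by (rule derivative_eq_intros z refl)+ (simp add: algebra_simps)
    moreover have "m * z'' t + k * z t = - \<gamma> * z' t"
      using z(3)[of t] by simp
    ultimately show ?thesis by (simp only: power2_eq_square mult_ac) (simp add: mult_ac)
  qed
  have "antimono e"
  proof (rule antimonoI)
    fix a b :: real assume "a \<le> b"
    then show "e b \<le> e a"
      by (rule DERIV_nonpos_imp_nonincreasing)
        (use de assms(2) in \<open>force simp: mult_nonneg_nonneg\<close>)
  qed
  moreover have "e (t + T) = e t" for t
    by (simp add: e_def per per')
  ultimately have "e s = e u" if "\<bar>s - u\<bar> < T" for s u
    using that by (rule periodic_antimono_imp_const)
  then have "- 2 * \<gamma> * (z' s)\<^sup>2 = 0" for s
    using DERIV_local_const[OF de assms(4)] by blast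
  then have z'0: "z' = (\<lambda>_. 0)"
    using assms(2) by (intro ext) auto
  \<comment> \<open>Zero velocity alone would allow any constant; with \<open>z''\<close> also zero
    the equation reads \<open>k * z t = 0\<close>, and \<open>k > 0\<close> leaves only
    zero.\<close>
  then have "z'' t = 0"
    using z(2)[of t] DERIV_unique DERIV_const by blast
  then show ?thesis
    using z(3)[of t] z'0 assms(3) by simp
qed

text \<open>Uniqueness resolves the definite description, so exhibiting one periodic solution
  identifies the steady state.\<close>

lemma steady_state_eqI:
  assumes "m > 0" "\<gamma> > 0" "k > 0" "T > 0"
    and "is_periodic_solution m \<gamma> k q T E x"
  shows "steady_state m \<gamma> k q T E = x"
  unfolding steady_state_def
proof (rule the_equality)
  show "is_periodic_solution m \<gamma> k q T E x" by fact
next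
  fix y assume "is_periodic_solution m \<gamma> k q T E y"
  from homogeneous_periodic_solution_eq_0[OF assms(1-4) is_periodic_solution_diff[OF this assms(5)]]
  show "y = x" by (intro ext) simp
qed

text \<open>With \<open>D = k - m * \<omega>\<^sup>2\<close> and \<open>\<phi>\<close> the angle,
  this is the polar form R exp(i \<phi>) = \<sigma> (D - i \<gamma> \<omega>). The sign
  \<open>\<sigma>\<close> is needed because the arctangent only yields angles in the right half
  plane, even when D is negative.\<close>

lemma theta_ss_cos_sin:
  fixes m \<gamma> k \<omega> :: real
  assumes "\<gamma> > 0" "\<omega> > 0"
  defines "R \<equiv> sqrt ((k - m * \<omega>\<^sup>2)\<^sup>2 + (\<gamma> * \<omega>)\<^sup>2)"
  obtains \<sigma> :: real where "\<sigma>\<^sup>2 = 1"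
    "R * cos (theta_ss m \<gamma> k \<omega>) = \<sigma> * (k - m * \<omega>\<^sup>2)"
    "R * sin (theta_ss m \<gamma> k \<omega>) = - \<sigma> * (\<gamma> * \<omega>)"
proof (cases "k = m * \<omega>\<^sup>2")
  case True
  \<comment> \<open>At resonance \<open>R = \<gamma> * \<omega>\<close> and the angle is
    \<open>- pi / 2\<close>. Here \<open>sgn D\<close> would be 0, so the sign is chosen as
    1.\<close>
  then show ?thesis
    using assms(1,2) by (intro that[of 1]) (auto simp: R_def theta_ss_def)
next
  case False
  define D where "D = k - m * \<omega>\<^sup>2"
  have D: "D \<noteq> 0" using False by (simp add: D_def)
  \<comment> \<open>This root is the denominator in the formulas for cosine and sine of an
    arctangent. The absolute value in \<open>R / \<bar>D\<bar>\<close> is the source of the factor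
    \<open>sgn D\<close>.\<close>
  have "1 + (\<gamma> * \<omega> / D)\<^sup>2 = (D\<^sup>2 + (\<gamma> * \<omega>)\<^sup>2) / D\<^sup>2"
    using D by (simp add: field_simps)
  then have s: "sqrt (1 + (\<gamma> * \<omega> / D)\<^sup>2) = R / \<bar>D\<bar>"
    by (simp add: R_def D_def real_sqrt_divide)
  have R: "R > 0"
    using assms(1,2) by (auto simp: R_def intro!: add_nonneg_pos)
  have th: "theta_ss m \<gamma> k \<omega> = - arctan (\<gamma> * \<omega> / D)"
    using False by (simp add: theta_ss_def D_def)
  show ?thesis
  proof (rule that[of "sgn D"])
    show "(sgn D)\<^sup>2 = 1" using D by (simp add: sgn_if)
    show "R * cos (theta_ss m \<gamma> k \<omega>) = sgn D * (k - m * \<omega>\<^sup>2)"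
      unfolding th cos_minus cos_arctan s D_def[symmetric]
      using R D by (simp add: sgn_if)
    show "R * sin (theta_ss m \<gamma> k \<omega>) = - sgn D * (\<gamma> * \<omega>)"
      unfolding th sin_minus sin_arctan s
      using R D by (simp add: sgn_if)
  qed
qed

text \<open>One amplitude \<open>B\<close> serves all phases \<open>\<theta>\<close>, so it factors
  out of sums and differences of displacements. Only its square is specified, which hides the sign
  \<open>\<sigma>\<close>.\<close>

lemma x_ss_sinusoid:
  assumes "m > 0" "\<gamma> > 0" "k > 0" "\<omega> > 0" and "\<forall>t. E\<^sub>r t = 0"
  obtains B where "B\<^sup>2 = (A_tilde m \<gamma> k q \<omega> A)\<^sup>2"
    "\<And>\<theta>. x_ss m \<gamma> k q \<omega> A E\<^sub>r \<theta> = (\<lambda>t. B * cos (\<omega> * t + \<theta> + theta_ss m \<gamma> k \<omega>))"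
proof -
  define R where "R = sqrt ((k - m * \<omega>\<^sup>2)\<^sup>2 + (\<gamma> * \<omega>)\<^sup>2)"
  define \<phi> where "\<phi> = theta_ss m \<gamma> k \<omega>"
  obtain \<sigma> :: real where \<sigma>: "\<sigma>\<^sup>2 = 1"
    and c: "R * cos \<phi> = \<sigma> * (k - m * \<omega>\<^sup>2)" and s: "R * sin \<phi> = - \<sigma> * (\<gamma> * \<omega>)"
    using theta_ss_cos_sin[OF assms(2,4)] unfolding R_def \<phi>_def by blast
  have R: "R > 0"
    using assms(2,4) by (auto simp: R_def intro!: add_nonneg_pos)
  define B where "B = \<sigma> * A_tilde m \<gamma> k q \<omega> A"
  have BR: "B * R = \<sigma> * (q * A)"
    using R unfolding B_def A_tilde_def R_def[symmetric] by simp
  have \<sigma>\<sigma>: "\<sigma> * (\<sigma> * a) = a" for a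
    using \<sigma> by (simp add: power2_eq_square flip: mult.assoc)
  \<comment> \<open>This is the equation of motion for the trial solution
    \<open>B * cos (u + \<phi>)\<close> with \<open>u = \<omega> * t + \<theta>\<close>.\<close>
  have force: "(k - m * \<omega>\<^sup>2) * (B * cos (u + \<phi>)) - \<gamma> * \<omega> * (B * sin (u + \<phi>)) = q * A * cos u" for u
  proof -
    \<comment> \<open>Inserting \<open>\<sigma> * \<sigma> = 1\<close> exposes the two expressions
      that equal \<open>R * cos \<phi>\<close> and \<open>R * sin \<phi>\<close>; the addition
      formula then undoes the phase shift.\<close>
    have "(k - m * \<omega>\<^sup>2) * (B * cos (u + \<phi>)) - \<gamma> * \<omega> * (B * sin (u + \<phi>))
        = \<sigma> * (\<sigma> * (k - m * \<omega>\<^sup>2)) * (B * cos (u + \<phi>)) + \<sigma> * (- \<sigma> * (\<gamma> * \<omega>)) * (B * sin (u + \<phi>))"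
      by (simp add: \<sigma>\<sigma>)
    also have "\<dots> = \<sigma> * (B * R) * (cos (u + \<phi>) * cos \<phi> + sin (u + \<phi>) * sin \<phi>)"
      unfolding c[symmetric] s[symmetric] by (simp add: algebra_simps)
    also have "\<dots> = q * A * cos (u + \<phi> - \<phi>)"
      unfolding BR \<sigma>\<sigma> cos_diff ..
    finally show ?thesis by simp
  qed
  have "x_ss m \<gamma> k q \<omega> A E\<^sub>r \<theta> = (\<lambda>t. B * cos (\<omega> * t + \<theta> + \<phi>))" for \<theta>
    unfolding x_ss_def
  proof (rule steady_state_eqI[OF assms(1-3)])
    show "period \<omega> > 0" using assms(4) by (simp add: period_def)
    let ?x = "\<lambda>t. B * cos (\<omega> * t + \<theta> + \<phi>)"
    let ?x' = "\<lambda>t. - (B * \<omega> * sin (\<omega> * t + \<theta> + \<phi>))"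
    let ?x'' = "\<lambda>t. - (B * \<omega>\<^sup>2 * cos (\<omega> * t + \<theta> + \<phi>))"
    have "?x (t + period \<omega>) = ?x t" for t
    proof -
      have "\<omega> * (t + period \<omega>) + \<theta> + \<phi> = (\<omega> * t + \<theta> + \<phi>) + 2 * pi"
        using assms(4) by (simp add: period_def field_simps)
      then show ?thesis by (simp only: cos_periodic)
    qed
    moreover have "(?x has_real_derivative ?x' t) (at t)"
      "(?x' has_real_derivative ?x'' t) (at t)" for t
      by (auto intro!: derivative_eq_intros simp: power2_eq_square)
    moreover have "m * ?x'' t + \<gamma> * ?x' t + k * ?x t = q * (E_in A \<omega> \<theta> t - E\<^sub>r t)" for t
      using force[of "\<omega> * t + \<theta>"] assms(5) by (simp add: E_in_def algebra_simps)
    ultimately show "is_periodic_solution m \<gamma> k q (period \<omega>) (\<lambda>t. E_in A \<omega> \<theta> t - E\<^sub>r t) ?x"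
      unfolding is_periodic_solution_def by (intro conjI exI[of _ ?x'] exI[of _ ?x'']) auto
  qed
  moreover have "B\<^sup>2 = (A_tilde m \<gamma> k q \<omega> A)\<^sup>2"
    by (simp add: B_def power_mult_distrib \<sigma>)
  ultimately show ?thesis using that unfolding \<phi>_def by blast
qed

text \<open>The product-to-sum formula splits the integrand into a constant and an oscillation of
  frequency \<open>4 * \<omega>\<close>, whose integral over the period vanishes.\<close>

lemma integral_sin_mult_sin_period:
  assumes "\<omega> > 0"
  shows "integral {0..period \<omega>} (\<lambda>t. sin (2 * \<omega> * t + \<alpha>) * sin (2 * \<omega> * t + \<beta>))
    = period \<omega> / 2 * cos (\<beta> - \<alpha>)"
proof -
  define F where "F = (\<lambda>t. t / 2 * cos (\<beta> - \<alpha>) - sin (4 * \<omega> * t + \<alpha> + \<beta>) / (8 * \<omega>))"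
  have "sin (2 * \<omega> * t + \<alpha>) * sin (2 * \<omega> * t + \<beta>)
      = cos (\<beta> - \<alpha>) / 2 - cos (4 * \<omega> * t + \<alpha> + \<beta>) / 2" for t
  proof -
    have "2 * \<omega> * t + \<alpha> - (2 * \<omega> * t + \<beta>) = - (\<beta> - \<alpha>)"
      "2 * \<omega> * t + \<alpha> + (2 * \<omega> * t + \<beta>) = 4 * \<omega> * t + \<alpha> + \<beta>" by simp_all
    then show ?thesis unfolding sin_times_sin by (simp only: cos_minus diff_divide_distrib)
  qed
  then have "(F has_real_derivative sin (2 * \<omega> * t + \<alpha>) * sin (2 * \<omega> * t + \<beta>)) (at t)" for t
    unfolding F_def using assms by (auto intro!: derivative_eq_intros)
  then have "((\<lambda>t. sin (2 * \<omega> * t + \<alpha>) * sin (2 * \<omega> * t + \<beta>)) has_integral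
      F (period \<omega>) - F 0) {0..period \<omega>}"
    using assms
    by (intro fundamental_theorem_of_calculus)
      (auto simp: period_def has_real_derivative_iff_has_vector_derivative[symmetric]
        intro: has_field_derivative_at_within)
  moreover have "F (period \<omega>) - F 0 = period \<omega> / 2 * cos (\<beta> - \<alpha>)"
  proof -
    \<comment> \<open>The phase advances by \<open>8 * pi\<close>, written as four summands so that
      \<open>sin_periodic\<close> can remove them one at a time.\<close>
    have "4 * \<omega> * period \<omega> + \<alpha> + \<beta> = (\<alpha> + \<beta> + 2 * pi) + 2 * pi + 2 * pi + 2 * pi"
      using assms by (simp add: period_def)
    then have "sin (4 * \<omega> * period \<omega> + \<alpha> + \<beta>) = sin (\<alpha> + \<beta>)"
      by (simp only: sin_periodic)
    then show ?thesis by (simp add: F_def)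
  qed
  ultimately show ?thesis by (simp add: integral_unique)
qed

text \<open>Sum times difference of the two displacements has this shape, with \<open>u\<close>
  carrying the time and \<open>v\<close> the incoming phase; the identity separates the two.\<close>

lemma cos_squared_diff:
  fixes u v :: real
  shows "(cos (u - v))\<^sup>2 - (cos (u + v))\<^sup>2 = sin (2 * u) * sin (2 * v)"
  unfolding cos_diff cos_add sin_double by (simp add: power2_eq_square algebra_simps)

theorem theorem2:
  fixes m \<gamma> k \<omega> q A I\<^sub>1 \<theta>\<^sub>c \<theta>p \<theta>m :: real
    and E\<^sub>r f\<^sub>c :: "real \<Rightarrow> real"
  assumes "m > 0" and "\<gamma> > 0" and "k > 0" and "\<omega> > 0"
    and "\<forall>t. E\<^sub>r t = 0"
    and "\<forall>t. f\<^sub>c t = sqrt 2 * sin (2 * \<omega> * t + \<theta>\<^sub>c)"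
    and "\<theta>p = - \<theta>m"
  shows "J_ss m \<gamma> k q \<omega> A I\<^sub>1 E\<^sub>r f\<^sub>c \<theta>p \<theta>m =
    \<bar>I\<^sub>1 * (A_tilde m \<gamma> k q \<omega> A)\<^sup>2 * sin (2 * \<theta>m) * cos (\<theta>\<^sub>c - 2 * theta_ss m \<gamma> k \<omega>)\<bar> / sqrt 2"
proof -
  let ?\<phi> = "theta_ss m \<gamma> k \<omega>" and ?x = "x_ss m \<gamma> k q \<omega> A E\<^sub>r" and ?T = "period \<omega>"
  obtain B where B: "B\<^sup>2 = (A_tilde m \<gamma> k q \<omega> A)\<^sup>2"
    and x: "\<And>\<theta>. ?x \<theta> = (\<lambda>t. B * cos (\<omega> * t + \<theta> + ?\<phi>))"
    using x_ss_sinusoid[OF assms(1-5)] by blast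
  have "(?x \<theta>p t + ?x \<theta>m t) * (?x \<theta>p t - ?x \<theta>m t) * f\<^sub>c t
      = B\<^sup>2 * sin (2 * \<theta>m) * sqrt 2 * (sin (2 * \<omega> * t + 2 * ?\<phi>) * sin (2 * \<omega> * t + \<theta>\<^sub>c))" for t
  proof -
    \<comment> \<open>Opposite incoming phases make the two displacements symmetric about this
      common argument.\<close>
    define u where "u = \<omega> * t + ?\<phi>"
    have "?x \<theta>p t = B * cos (u - \<theta>m)" "?x \<theta>m t = B * cos (u + \<theta>m)"
      using assms(7) by (simp_all add: x u_def algebra_simps)
    then have "(?x \<theta>p t + ?x \<theta>m t) * (?x \<theta>p t - ?x \<theta>m t)
        = B\<^sup>2 * ((cos (u - \<theta>m))\<^sup>2 - (cos (u + \<theta>m))\<^sup>2)"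
      by (simp add: power2_eq_square algebra_simps)
    also have "\<dots> = B\<^sup>2 * (sin (2 * \<omega> * t + 2 * ?\<phi>) * sin (2 * \<theta>m))"
      unfolding cos_squared_diff by (simp add: u_def algebra_simps)
    finally show ?thesis using assms(6) by simp
  qed
  \<comment> \<open>The integral is taken with \<open>\<alpha> = 2 * ?\<phi>\<close> and
    \<open>\<beta> = \<theta>\<^sub>c\<close>; its factor \<open>?T\<close> then cancels against the
    averaging factor in front.\<close>
  then have "J_ss m \<gamma> k q \<omega> A I\<^sub>1 E\<^sub>r f\<^sub>c \<theta>p \<theta>m
      = \<bar>I\<^sub>1 / ?T * (B\<^sup>2 * sin (2 * \<theta>m) * sqrt 2 * (?T / 2 * cos (\<theta>\<^sub>c - 2 * ?\<phi>)))\<bar>"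
    unfolding J_ss_def by (simp add: integral_sin_mult_sin_period[OF assms(4)])
  also have "\<dots> = \<bar>I\<^sub>1 * B\<^sup>2 * sin (2 * \<theta>m) * cos (\<theta>\<^sub>c - 2 * ?\<phi>) * (sqrt 2 / 2)\<bar>"
    using assms(4) by (simp add: period_def mult_ac)
  also have "\<dots> = \<bar>I\<^sub>1 * B\<^sup>2 * sin (2 * \<theta>m) * cos (\<theta>\<^sub>c - 2 * ?\<phi>)\<bar> * (sqrt 2 / 2)"
    by (simp add: abs_mult)
  also have "sqrt 2 / 2 = 1 / sqrt (2 :: real)"
    by (simp add: field_simps)
  finally show ?thesis by (simp add: B)
qed

end
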